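(* Let $H>\frac12$ and $\lambda>0$, and let $Z^1_{H,\lambda}$ be the tempered Hermite process of order one. Then for $t\ge0$, $$Z^1_{H,\lambda}(t)=\Gamma\big(H-\tfrac12\big)\int_{-\infty}^{+\infty}\Big(\mathbb I_-^{H-\frac12,\lambda}\mathbf 1_{[0,t]}\Big)(x)\,B(dx).$$
   Context: $B(dx)$ is an independently scattered Gaussian random measure on $\mathbb R$ with control measure $\sigma^2dx$; $(x)_+=x\,I(x>0)$, and powers $(x)_+^{p}$ are $0$ for $x\le 0$. The tempered Hermite process of order one is $Z^1_{H,\lambda}(t)=\int_{\mathbb R}\int_0^t(s-y)_+^{H-\frac32}e^{-\lambda(s-y)_+}\,ds\,B(dy)$. The negative tempered fractional integral of order $\alpha>0$ with $\lambda>0$ of $f\in L^p(\mathbb R)$, $1\le p<\infty$, is $$\mathbb I^{\alpha,\lambda}_-f(t)=\frac1{\Gamma(\alpha)}\int_{-\infty}^\infty f(u)(u-t)_+^{\alpha-1}e^{-\lambda(u-t)_+}\,du .$$ *)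

theory Defs
  imports "HOL-Probability.Probability"
begin

section \<open>Gaussian random measures on the real line\<close>

text \<open>The law \<open>N(0, v)\<close> for \<open>v \<ge> 0\<close>.  The degenerate case is needed because the random
  measure is also evaluated on Lebesgue null sets.\<close>

definition centered_gaussian :: "real \<Rightarrow> real measure" where
  "centered_gaussian v =
     (if v = 0 then return borel 0 else density lborel (normal_density 0 (sqrt v)))"

definition finite_borel_sets :: "real set set" where
  "finite_borel_sets = {A \<in> sets borel. emeasure lborel A < \<infinity>}"

text \<open>The random measure \<open>B\<close> is only meaningful on \<open>finite_borel_sets\<close>; its values on
  other sets are unconstrained.  Since every sequence may be padded with empty sets, the last two
  assumptions include the corresponding statements about finite families.\<close>

locale gaussian_random_measure = prob_space M
  for M :: "'a measure" and B :: "real set \<Rightarrow> 'a \<Rightarrow> real" and \<sigma> :: real +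
  assumes measurable_B:
      "\<And>A. A \<in> finite_borel_sets \<Longrightarrow> random_variable borel (B A)"
    and law_B:
      "\<And>A. A \<in> finite_borel_sets \<Longrightarrow>
         distr M borel (B A) = centered_gaussian (\<sigma>\<^sup>2 * measure lborel A)"
    and independently_scattered:
      "\<And>A :: nat \<Rightarrow> real set. range A \<subseteq> finite_borel_sets \<Longrightarrow> disjoint_family A \<Longrightarrow>
         indep_vars (\<lambda>_. borel) (\<lambda>i. B (A i)) UNIV"
    and countably_additive_B:
      "\<And>A :: nat \<Rightarrow> real set. range A \<subseteq> finite_borel_sets \<Longrightarrow> disjoint_family A \<Longrightarrow>
         (\<Union>i. A i) \<in> finite_borel_sets \<Longrightarrow>
         (AE \<omega> in M. (\<lambda>i. B (A i) \<omega>) sums B (\<Union>i. A i) \<omega>)"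

section \<open>The integral of a deterministic function\<close>

text \<open>The integral of \<open>\<Sum>\<^sub>j c\<^sub>j 1\<^bsub>A\<^sub>j\<^esub>\<close> is \<open>\<Sum>\<^sub>j c\<^sub>j B(A\<^sub>j)\<close>, taken in the canonical representation
  as in \<^const>\<open>Bochner_Integration.simple_bochner_integral\<close>.  The level set of the value \<open>0\<close> may have infinite measure,
  but its contribution carries the factor \<open>0\<close>.\<close>

definition simple_wiener_integral ::
    "(real set \<Rightarrow> 'a \<Rightarrow> real) \<Rightarrow> (real \<Rightarrow> real) \<Rightarrow> 'a \<Rightarrow> real" where
  "simple_wiener_integral B s \<omega> = (\<Sum>c\<in>range s. c * B (s -` {c}) \<omega>)"

text \<open>Extension to \<open>L\<^sup>2(\<real>)\<close> by approximation: \<open>s n \<rightarrow> f\<close> in \<open>L\<^sup>2(\<real>)\<close> and the integrals of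
  \<open>s n\<close> tend to \<open>X\<close> in \<open>L\<^sup>2(M)\<close>.\<close>

definition has_wiener_integral ::
    "'a measure \<Rightarrow> (real set \<Rightarrow> 'a \<Rightarrow> real) \<Rightarrow> (real \<Rightarrow> real) \<Rightarrow> ('a \<Rightarrow> real) \<Rightarrow> bool" where
  "has_wiener_integral M B f X \<longleftrightarrow>
     f \<in> borel_measurable lborel \<and> X \<in> borel_measurable M \<and>
     (\<exists>s. (\<forall>n. Bochner_Integration.simple_bochner_integrable lborel (s n)) \<and>
        (\<lambda>n. \<integral>\<^sup>+x. ennreal ((s n x - f x)\<^sup>2) \<partial>lborel) \<longlonglongrightarrow> 0 \<and>
        (\<lambda>n. \<integral>\<^sup>+\<omega>. ennreal ((simple_wiener_integral B (s n) \<omega> - X \<omega>)\<^sup>2) \<partial>M) \<longlonglongrightarrow> 0)"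

definition wiener_integrable ::
    "'a measure \<Rightarrow> (real set \<Rightarrow> 'a \<Rightarrow> real) \<Rightarrow> (real \<Rightarrow> real) \<Rightarrow> bool" where
  "wiener_integrable M B f \<longleftrightarrow> (\<exists>X. has_wiener_integral M B f X)"

text \<open>The integral is determined only up to almost sure equality, so an arbitrary version is
  chosen.\<close>

definition wiener_integral ::
    "'a measure \<Rightarrow> (real set \<Rightarrow> 'a \<Rightarrow> real) \<Rightarrow> (real \<Rightarrow> real) \<Rightarrow> 'a \<Rightarrow> real" where
  "wiener_integral M B f = (SOME X. has_wiener_integral M B f X)"

section \<open>Tempered fractional integrals and the tempered Hermite process of order one\<close>

text \<open>As \<open>0 powr p = 0\<close> for every \<open>p\<close>, also for \<open>p \<le> 0\<close>, the term \<open>pos x powr p\<close> vanishes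
  for all \<open>x \<le> 0\<close>.\<close>

definition pos :: "real \<Rightarrow> real" where
  "pos x = (if x > 0 then x else 0)"

definition neg_tempered_frac_integral :: "real \<Rightarrow> real \<Rightarrow> (real \<Rightarrow> real) \<Rightarrow> real \<Rightarrow> real" where
  "neg_tempered_frac_integral \<alpha> lam f t =
     1 / Gamma \<alpha> * (LBINT u. f u * pos (u - t) powr (\<alpha> - 1) * exp (- lam * pos (u - t)))"

definition tempered_hermite1 ::
    "'a measure \<Rightarrow> (real set \<Rightarrow> 'a \<Rightarrow> real) \<Rightarrow> real \<Rightarrow> real \<Rightarrow> real \<Rightarrow> 'a \<Rightarrow> real" where
  "tempered_hermite1 M B H lam t =
     wiener_integral M B
       (\<lambda>y. LBINT s=0..t. pos (s - y) powr (H - 3 / 2) * exp (- lam * pos (s - y)))"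

end

theory Submission
  imports Defs
begin

text \<open>
  Both sides integrate the same deterministic function against \<open>B\<close>. Restricting
  \<open>(u - y)\<^sub>+ powr (H - 3/2) * exp (- lam * (u - y)\<^sub>+)\<close> to \<open>u \<in> [0, t]\<close> and integrating over \<open>u\<close> is, by
  definition, \<open>\<Gamma>(H - 1/2)\<close> times the tempered fractional integral of the indicator of \<open>[0, t]\<close>, for
  every \<open>y\<close>. What remains is to show that the stochastic integral behaves as an integral: it exists for
  this function, it does not depend (up to null sets) on the version that the choice operator selects,
  and the nonzero constant \<open>\<Gamma>(H - 1/2)\<close> can be moved through it.

  The Wiener integral is controlled by the isometry
  \<open>E (I s - I s')\<^sup>2 = \<sigma>\<^sup>2 \<integral> (s - s')\<^sup>2\<close> for simple \<open>s\<close> and \<open>s'\<close> (\<open>simple_wiener_isometry\<close>), which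
  holds because \<open>B\<close> is almost surely additive and its values on disjoint sets are independent and
  centred, hence orthogonal. Density of simple functions in \<open>L\<^sup>2\<close> and completeness of \<open>L\<^sup>2(M)\<close>
  (\<open>simple_functions_dense\<close>, \<open>sq_dist_complete\<close>) then give existence for every square integrable
  function, and the isometry also makes the limit independent of the approximating sequence
  (\<open>has_wiener_integral_exists\<close>, \<open>has_wiener_integral_unique\<close>). Multiplication by a nonzero constant
  merely relabels the level sets of a simple function (\<open>has_wiener_integral_scale\<close>).

  Square integrability of the integrand is the one place where \<open>H > 1/2\<close> and \<open>lam > 0\<close> enter as
  analytic conditions. They say exactly that the kernel is integrable over the line, its total mass being
  a Gamma integral (\<open>nn_integral_tempered_kernel\<close>). The kernel need not be square integrable (for \<open>H \<le> 1\<close>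
  its singularity at \<open>0\<close> is too strong), but integrating it over a window of finite measure produces a
  function that is both bounded and integrable, hence square integrable
  (\<open>square_integrable_window_convolution\<close>).
\<close>

section \<open>Square distances, completeness and density\<close>

text \<open>The squared \<open>L\<^sup>2\<close> distance takes values in the extended nonnegative reals, so that it makes sense
  without integrability assumptions and matches the limits that define the Wiener integral.\<close>

definition sq_dist :: "'b measure \<Rightarrow> ('b \<Rightarrow> real) \<Rightarrow> ('b \<Rightarrow> real) \<Rightarrow> ennreal" where
  "sq_dist N f g = (\<integral>\<^sup>+x. ennreal ((f x - g x)\<^sup>2) \<partial>N)"

lemma sq_dist_commute: "sq_dist N f g = sq_dist N g f"
  by (simp add: sq_dist_def power2_commute)

text \<open>A substitute for the triangle inequality that avoids square roots; the factor \<open>2\<close> is harmless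
  in limit arguments.\<close>

lemma sq_dist_triangle:
  assumes [measurable]: "f \<in> borel_measurable N" "g \<in> borel_measurable N" "h \<in> borel_measurable N"
  shows "sq_dist N f h \<le> 2 * sq_dist N f g + 2 * sq_dist N g h"
proof -
  have "(f x - h x)\<^sup>2 \<le> 2 * (f x - g x)\<^sup>2 + 2 * (g x - h x)\<^sup>2" for x
    using zero_le_power2[of "(f x - g x) - (g x - h x)"]
    by (simp add: power2_eq_square algebra_simps)
  then have "ennreal ((f x - h x)\<^sup>2) \<le> 2 * ennreal ((f x - g x)\<^sup>2) + 2 * ennreal ((g x - h x)\<^sup>2)" for x
    by (simp add: ennreal_plus[symmetric] ennreal_mult'[symmetric] del: ennreal_plus
        flip: ennreal_numeral)
  then have "sq_dist N f h \<le> (\<integral>\<^sup>+x. 2 * ennreal ((f x - g x)\<^sup>2) + 2 * ennreal ((g x - h x)\<^sup>2) \<partial>N)"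
    unfolding sq_dist_def by (intro nn_integral_mono)
  also have "\<dots> = 2 * sq_dist N f g + 2 * sq_dist N g h"
    unfolding sq_dist_def by (simp add: nn_integral_add nn_integral_cmult)
  finally show ?thesis .
qed

lemma sq_dist_scale:
  assumes [measurable]: "f \<in> borel_measurable N" "g \<in> borel_measurable N"
  shows "sq_dist N (\<lambda>x. c * f x) (\<lambda>x. c * g x) = ennreal (c\<^sup>2) * sq_dist N f g"
  unfolding sq_dist_def
  by (simp add: right_diff_distrib[symmetric] power_mult_distrib ennreal_mult' nn_integral_cmult)

lemma sq_dist_eq_0D:
  assumes [measurable]: "f \<in> borel_measurable N" "g \<in> borel_measurable N"
    and "sq_dist N f g = 0"
  shows "AE x in N. f x = g x"
  using assms(3) unfolding sq_dist_def
  by (subst (asm) nn_integral_0_iff_AE) (auto simp: ennreal_eq_0_iff)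

lemma tendsto_0_ennreal_linear:
  fixes u v :: "nat \<Rightarrow> ennreal"
  assumes "u \<longlonglongrightarrow> 0" "v \<longlonglongrightarrow> 0" "a < \<infinity>" "b < \<infinity>"
  shows "(\<lambda>n. a * u n + b * v n) \<longlonglongrightarrow> 0"
proof -
  have "(\<lambda>n. a * u n) \<longlonglongrightarrow> a * 0" "(\<lambda>n. b * v n) \<longlonglongrightarrow> b * 0"
    using assms by (simp_all only: ennreal_tendsto_cmult less_top infinity_ennreal_def)
  from tendsto_add[OF this] show ?thesis by simp
qed

text \<open>The weights \<open>2 ^ n\<close> turn square summability into absolute summability: by the inequality between
  arithmetic and geometric mean, \<open>2 * z \<le> 2 ^ (- n) + 2 ^ n * z\<^sup>2\<close> for \<open>z = \<bar>d (n + 1) - d n\<bar>\<close>.\<close>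

lemma convergent_if_weighted_square_increments_summable:
  fixes d :: "nat \<Rightarrow> real"
  assumes "summable (\<lambda>n. 2 ^ n * (d n - d (Suc n))\<^sup>2)"
  shows "convergent d"
proof -
  have bound: "\<bar>d (Suc n) - d n\<bar> \<le> (1/2) ^ n + 2 ^ n * (d n - d (Suc n))\<^sup>2" for n
  proof -
    define z where "z = \<bar>d (Suc n) - d n\<bar>"
    have "0 \<le> (1/2) ^ n * (1 - 2 ^ n * z)\<^sup>2" by simp
    also have "\<dots> = (1/2) ^ n - 2 * z + 2 ^ n * z\<^sup>2"
      by (simp add: power2_eq_square algebra_simps power_one_over)
    finally have "2 * z \<le> (1/2) ^ n + 2 ^ n * z\<^sup>2" by simp
    moreover have "0 \<le> z" by (simp add: z_def)
    moreover have "z\<^sup>2 = (d n - d (Suc n))\<^sup>2" by (simp add: z_def power2_commute)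
    ultimately have "z \<le> (1/2) ^ n + 2 ^ n * (d n - d (Suc n))\<^sup>2" by simp
    then show ?thesis by (simp only: z_def)
  qed
  have "summable (\<lambda>n. (1/2) ^ n + 2 ^ n * (d n - d (Suc n))\<^sup>2)"
    using assms by (intro summable_add summable_geometric) auto
  then have "summable (\<lambda>n. d (Suc n) - d n)"
    by (rule summable_comparison_test'[where N=0]) (use bound in auto)
  then have "convergent (\<lambda>n. \<Sum>i<n. d (Suc i) - d i)"
    by (simp add: summable_iff_convergent)
  then have "convergent (\<lambda>n. d n - d 0)"
    by (simp add: sum_lessThan_telescope)
  from convergent_add[OF this convergent_const[of "d 0"]] show ?thesis by simp
qed

text \<open>The Riesz--Fischer argument: a subsequence with rapidly decreasing increments converges almost
  everywhere, and Fatou's lemma turns the Cauchy condition into convergence of the whole sequence to its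
  limit. Weighting the squared increments, instead of summing their absolute values, makes the argument
  valid on measure spaces of infinite measure as well.\<close>

lemma sq_dist_complete:
  fixes X :: "nat \<Rightarrow> 'b \<Rightarrow> real"
  assumes [measurable]: "\<And>n. X n \<in> borel_measurable N"
    and Cauchy: "\<And>e. e > 0 \<Longrightarrow> \<exists>n0. \<forall>m\<ge>n0. \<forall>n\<ge>n0. sq_dist N (X m) (X n) \<le> ennreal e"
  shows "\<exists>Y\<in>borel_measurable N. (\<lambda>n. sq_dist N (X n) Y) \<longlonglongrightarrow> 0"
proof -
  have "\<exists>n0. \<forall>m\<ge>n0. \<forall>n\<ge>n0. sq_dist N (X m) (X n) \<le> ennreal ((1/4) ^ i)" for i
    by (rule Cauchy) simp
  then obtain n0 where n0: "\<And>i m n. m \<ge> n0 i \<Longrightarrow> n \<ge> n0 i \<Longrightarrow> sq_dist N (X m) (X n) \<le> ennreal ((1/4) ^ i)"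
    by metis
  \<comment> \<open>Summing the thresholds makes the subsequence monotone; the summand \<open>k\<close> makes it unbounded.\<close>
  define r where "r k = k + (\<Sum>i\<le>k. n0 i)" for k
  have r_ge: "n0 k \<le> r k" "k \<le> r k" "r k \<le> r (Suc k)" for k
    by (auto simp: r_def intro!: trans_le_add2 member_le_sum)
  define D where "D k = X (r k)" for k
  have [measurable]: "D k \<in> borel_measurable N" for k by (simp add: D_def)
  have D_step: "sq_dist N (D k) (D (Suc k)) \<le> ennreal ((1/4) ^ k)" for k
    unfolding D_def by (rule n0) (use r_ge order_trans in blast)+
  define Y where "Y x = lim (\<lambda>k. D k x)" for x
  have [measurable]: "Y \<in> borel_measurable N" unfolding Y_def by measurable
  have "(\<integral>\<^sup>+x. (\<Sum>k. ennreal (2 ^ k * (D k x - D (Suc k) x)\<^sup>2)) \<partial>N)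
      = (\<Sum>k. ennreal (2 ^ k) * sq_dist N (D k) (D (Suc k)))"
    by (subst nn_integral_suminf) (auto simp: sq_dist_def ennreal_mult' nn_integral_cmult)
  also have "\<dots> \<le> (\<Sum>k. ennreal ((1/2) ^ k))"
  proof (rule suminf_le[OF _ summableI summableI])
    fix k
    have "ennreal (2 ^ k) * sq_dist N (D k) (D (Suc k)) \<le> ennreal (2 ^ k) * ennreal ((1/4) ^ k)"
      by (intro mult_left_mono D_step) simp
    also have "\<dots> = ennreal ((1/2) ^ k)"
      by (simp add: ennreal_mult'[symmetric] power_mult_distrib[symmetric])
    finally show "ennreal (2 ^ k) * sq_dist N (D k) (D (Suc k)) \<le> ennreal ((1/2) ^ k)" .
  qed
  also have "\<dots> < \<infinity>"
    by (subst suminf_ennreal2) (auto simp: summable_geometric)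
  finally have "AE x in N. (\<Sum>k. ennreal (2 ^ k * (D k x - D (Suc k) x)\<^sup>2)) \<noteq> \<infinity>"
    by (intro nn_integral_PInf_AE) auto
  then have lim: "AE x in N. (\<lambda>k. D k x) \<longlonglongrightarrow> Y x"
  proof eventually_elim
    case (elim x)
    then have "summable (\<lambda>k. 2 ^ k * (D k x - D (Suc k) x)\<^sup>2)"
      by (intro summable_suminf_not_top) (auto simp: top_ennreal_def[symmetric])
    then show ?case unfolding Y_def
      by (intro convergent_LIMSEQ_iff[THEN iffD1] convergent_if_weighted_square_increments_summable)
  qed
  have close: "\<exists>n1. \<forall>n\<ge>n1. sq_dist N (X n) Y \<le> ennreal e" if "e > 0" for e
  proof -
    from Cauchy[OF that] obtain n1 where
      n1: "\<And>m n. m \<ge> n1 \<Longrightarrow> n \<ge> n1 \<Longrightarrow> sq_dist N (X m) (X n) \<le> ennreal e" by blast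
    have "sq_dist N (X n) Y \<le> ennreal e" if n: "n \<ge> n1" for n
    proof -
      have "sq_dist N (X n) Y = (\<integral>\<^sup>+x. liminf (\<lambda>k. ennreal ((X n x - D k x)\<^sup>2)) \<partial>N)"
        unfolding sq_dist_def
      proof (rule nn_integral_cong_AE)
        show "AE x in N. ennreal ((X n x - Y x)\<^sup>2) = liminf (\<lambda>k. ennreal ((X n x - D k x)\<^sup>2))"
          using lim
        proof eventually_elim
          case (elim x)
          then have "(\<lambda>k. ennreal ((X n x - D k x)\<^sup>2)) \<longlonglongrightarrow> ennreal ((X n x - Y x)\<^sup>2)"
            by (intro tendsto_intros)
          from lim_imp_Liminf[OF _ this] show ?case by simp
        qed
      qed
      also have "\<dots> \<le> liminf (\<lambda>k. sq_dist N (X n) (D k))"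
        unfolding sq_dist_def by (rule nn_integral_liminf) measurable
      also have "\<dots> \<le> ennreal e"
      proof (rule Liminf_le)
        show "\<forall>\<^sub>F k in sequentially. sq_dist N (X n) (D k) \<le> ennreal e"
          using eventually_ge_at_top[of n1]
          by eventually_elim (auto simp: D_def intro!: n1 n intro: order_trans[OF _ r_ge(2)])
      qed simp
      finally show ?thesis .
    qed
    then show ?thesis by blast
  qed
  have "(\<lambda>n. sq_dist N (X n) Y) \<longlonglongrightarrow> 0"
  proof (rule order_tendstoI)
    fix a :: ennreal assume "0 < a"
    then obtain b where b: "0 < b" "b < a" using dense by blast
    then obtain e where e: "e > 0" "ennreal e < a" by (cases b) auto
    from close[OF e(1)] e(2) show "\<forall>\<^sub>F n in sequentially. sq_dist N (X n) Y < a"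
      unfolding eventually_sequentially using le_less_trans by blast
  qed simp
  then show ?thesis by (intro bexI[of _ Y]) auto
qed

text \<open>A measurable function is a pointwise limit of simple functions bounded by \<open>2 * \<bar>f\<bar>\<close>, and dominated
  convergence with the bound \<open>9 * f\<^sup>2\<close> upgrades this to convergence in \<open>L\<^sup>2\<close>. The domination also forces
  the simple functions to be supported on sets of finite measure.\<close>

lemma simple_functions_dense:
  assumes f[measurable]: "f \<in> borel_measurable N" and fin: "(\<integral>\<^sup>+x. ennreal ((f x)\<^sup>2) \<partial>N) < \<infinity>"
  shows "\<exists>s. (\<forall>n. Bochner_Integration.simple_bochner_integrable N (s n)) \<and>
             (\<lambda>n. sq_dist N (s n) f) \<longlonglongrightarrow> 0"
proof -
  obtain s where s: "\<And>n. simple_function N (s n)" "\<And>x. x \<in> space N \<Longrightarrow> (\<lambda>n. s n x) \<longlonglongrightarrow> f x"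
    "\<And>n x. x \<in> space N \<Longrightarrow> \<bar>s n x\<bar> \<le> 2 * \<bar>f x\<bar>"
    using borel_measurable_implies_sequence_metric[OF f, of 0] unfolding dist_real_def diff_0_right
    by metis
  have [measurable]: "s n \<in> borel_measurable N" for n
    using s(1) by (rule borel_measurable_simple_function)
  have "Bochner_Integration.simple_bochner_integrable N (s n)" for n
  proof (rule Bochner_Integration.simple_bochner_integrable.intros[OF s(1)])
    have "(s n x)\<^sup>2 \<le> 4 * (f x)\<^sup>2" if "x \<in> space N" for x
      using power_mono[OF s(3)[OF that], of n 2] by (simp add: power_mult_distrib)
    then have "(\<integral>\<^sup>+x. ennreal ((s n x)\<^sup>2) \<partial>N) \<le> (\<integral>\<^sup>+x. 4 * ennreal ((f x)\<^sup>2) \<partial>N)"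
      by (intro nn_integral_mono) (simp add: ennreal_mult'[symmetric] flip: ennreal_numeral)
    also have "\<dots> < \<infinity>" using fin by (simp add: nn_integral_cmult ennreal_mult_less_top)
    finally have "(\<integral>\<^sup>+x. ennreal ((s n x)\<^sup>2) \<partial>N) < \<infinity>" .
    then have "emeasure N {x \<in> space N. ennreal ((s n x)\<^sup>2) \<noteq> 0} \<noteq> \<infinity>"
      by (intro simple_function_finite_support simple_function_compose1[where g="\<lambda>y. ennreal (y\<^sup>2)"] s(1))
         auto
    then show "emeasure N {x \<in> space N. s n x \<noteq> 0} \<noteq> \<infinity>"
      by (simp add: ennreal_eq_0_iff)
  qed
  moreover have "(\<lambda>n. sq_dist N (s n) f) \<longlonglongrightarrow> (\<integral>\<^sup>+x. 0 \<partial>N)"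
    unfolding sq_dist_def
  proof (rule nn_integral_dominated_convergence[where w="\<lambda>x. 9 * ennreal ((f x)\<^sup>2)"])
    show "AE x in N. ennreal ((s n x - f x)\<^sup>2) \<le> 9 * ennreal ((f x)\<^sup>2)" for n
    proof (rule AE_I2)
      fix x assume "x \<in> space N"
      then have "\<bar>s n x - f x\<bar> \<le> 3 * \<bar>f x\<bar>" using s(3)[of x n] by linarith
      then have "(s n x - f x)\<^sup>2 \<le> 9 * (f x)\<^sup>2"
        using power_mono[of "\<bar>s n x - f x\<bar>" "3 * \<bar>f x\<bar>" 2] by (simp add: power_mult_distrib)
      then show "ennreal ((s n x - f x)\<^sup>2) \<le> 9 * ennreal ((f x)\<^sup>2)"
        by (simp add: ennreal_mult'[symmetric] flip: ennreal_numeral)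
    qed
    show "AE x in N. (\<lambda>n. ennreal ((s n x - f x)\<^sup>2)) \<longlonglongrightarrow> 0"
    proof (rule AE_I2)
      fix x assume "x \<in> space N"
      then have "(\<lambda>n. ennreal ((s n x - f x)\<^sup>2)) \<longlonglongrightarrow> ennreal ((f x - f x)\<^sup>2)"
        by (intro tendsto_intros s(2))
      then show "(\<lambda>n. ennreal ((s n x - f x)\<^sup>2)) \<longlonglongrightarrow> 0" by simp
    qed
    show "(\<integral>\<^sup>+x. 9 * ennreal ((f x)\<^sup>2) \<partial>N) < \<infinity>"
      using fin by (simp add: nn_integral_cmult ennreal_mult_less_top)
  qed measurable
  ultimately show ?thesis by auto
qed

section \<open>Moments and additivity of the random measure\<close>

lemma finite_borel_sets_iff: "A \<in> finite_borel_sets \<longleftrightarrow> A \<in> sets borel \<and> emeasure lborel A < \<infinity>"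
  by (simp add: finite_borel_sets_def)

lemma finite_borel_sets_empty [simp]: "{} \<in> finite_borel_sets"
  by (simp add: finite_borel_sets_iff)

lemma finite_borel_sets_Un:
  "A \<in> finite_borel_sets \<Longrightarrow> A' \<in> finite_borel_sets \<Longrightarrow> A \<union> A' \<in> finite_borel_sets"
  using emeasure_subadditive[of A lborel A']
  by (auto simp: finite_borel_sets_iff intro: le_less_trans)

lemma finite_borel_sets_UN:
  "finite J \<Longrightarrow> (\<And>j. j \<in> J \<Longrightarrow> A j \<in> finite_borel_sets) \<Longrightarrow> (\<Union>j\<in>J. A j) \<in> finite_borel_sets"
  by (induction J rule: finite_induct) (auto intro: finite_borel_sets_Un)

lemma centered_gaussian_moments:
  assumes "v \<ge> 0"
  shows "integrable (centered_gaussian v) (\<lambda>x. x)"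
    and "integral\<^sup>L (centered_gaussian v) (\<lambda>x. x) = 0"
    and "integrable (centered_gaussian v) (\<lambda>x. x\<^sup>2)"
    and "integral\<^sup>L (centered_gaussian v) (\<lambda>x. x\<^sup>2) = v"
proof -
  have *: "integrable (centered_gaussian v) (\<lambda>x. x) \<and> integral\<^sup>L (centered_gaussian v) (\<lambda>x. x) = 0
    \<and> integrable (centered_gaussian v) (\<lambda>x. x\<^sup>2) \<and> integral\<^sup>L (centered_gaussian v) (\<lambda>x. x\<^sup>2) = v"
  proof (cases "v = 0")
    case True
    have fin: "integrable (return borel (0::real)) f" if "f \<in> borel_measurable borel" for f :: "real \<Rightarrow> real"
      using that by (subst integrable_iff_bounded) (simp add: nn_integral_return)
    show ?thesis
      using True by (simp add: centered_gaussian_def integral_return fin)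
  next
    case False
    with assms have v: "sqrt v > 0" by simp
    have m1: "has_bochner_integral lborel (\<lambda>x. normal_density 0 (sqrt v) x * x) 0"
      by (rule normal_moment_nz_1[OF v])
    have m2: "has_bochner_integral lborel (\<lambda>x. normal_density 0 (sqrt v) x * x\<^sup>2) v"
      using normal_moment_even[OF v, of 0 1] assms by (simp add: fact_numeral)
    show ?thesis using False m1 m2
      by (simp add: centered_gaussian_def integrable_density integral_density
          normal_density_nonneg has_bochner_integral_iff)
  qed
  then show "integrable (centered_gaussian v) (\<lambda>x. x)"
    and "integral\<^sup>L (centered_gaussian v) (\<lambda>x. x) = 0"
    and "integrable (centered_gaussian v) (\<lambda>x. x\<^sup>2)"
    and "integral\<^sup>L (centered_gaussian v) (\<lambda>x. x\<^sup>2) = v" by blast+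
qed

context gaussian_random_measure
begin

lemma B_moments:
  assumes A: "A \<in> finite_borel_sets"
  shows "integrable M (B A)" "expectation (B A) = 0"
    and "integrable M (\<lambda>\<omega>. (B A \<omega>)\<^sup>2)" "expectation (\<lambda>\<omega>. (B A \<omega>)\<^sup>2) = \<sigma>\<^sup>2 * measure lborel A"
proof -
  note [measurable] = measurable_B[OF A]
  have v: "0 \<le> \<sigma>\<^sup>2 * measure lborel A" by simp
  note m = centered_gaussian_moments[OF v, folded law_B[OF A]]
  show "integrable M (B A)" using m(1) by (subst (asm) integrable_distr_eq) auto
  show "integrable M (\<lambda>\<omega>. (B A \<omega>)\<^sup>2)" using m(3) by (subst (asm) integrable_distr_eq) auto
  show "expectation (B A) = 0" using m(2) by (subst (asm) integral_distr) auto
  show "expectation (\<lambda>\<omega>. (B A \<omega>)\<^sup>2) = \<sigma>\<^sup>2 * measure lborel A"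
    using m(4) by (subst (asm) integral_distr) auto
qed

lemma B_empty: "AE \<omega> in M. B {} \<omega> = 0"
proof -
  note [measurable] = measurable_B[of "{}", simplified]
  have "distr M borel (B {}) = return borel 0"
    using law_B[of "{}"] by (simp add: centered_gaussian_def)
  moreover have "AE x in return borel (0::real). x = 0" by (subst AE_return) auto
  ultimately have "AE x in distr M borel (B {}). x = 0" by (simp only:)
  then show ?thesis by (subst (asm) AE_distr_iff) auto
qed

text \<open>Independent centred variables are uncorrelated. The pair of sets is padded with empty sets to a
  disjoint sequence, the form in which independence is assumed.\<close>

lemma B_orthogonal:
  assumes A: "A \<in> finite_borel_sets" "A' \<in> finite_borel_sets" and disj: "A \<inter> A' = {}"
  shows "integrable M (\<lambda>\<omega>. B A \<omega> * B A' \<omega>)" "expectation (\<lambda>\<omega>. B A \<omega> * B A' \<omega>) = 0"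
proof -
  let ?b = "binaryset A A'"
  have "indep_vars (\<lambda>_. borel) (\<lambda>i. B (?b i)) UNIV"
    using A disj
    by (intro independently_scattered)
       (auto simp: binaryset_def disjoint_family_on_def)
  then have "indep_vars (\<lambda>_. borel) (\<lambda>i. B (?b i)) {0, 1}"
    by (rule indep_vars_subset) auto
  note ind = this
  have "\<And>i. i \<in> {0, 1} \<Longrightarrow> integrable M (B (?b i))"
    using A B_moments(1) by (auto simp: binaryset_def)
  note prod = indep_vars_lebesgue_integral[OF _ ind this] indep_vars_integrable[OF _ ind this]
  show "integrable M (\<lambda>\<omega>. B A \<omega> * B A' \<omega>)"
    using prod(2) by (simp add: binaryset_def)
  show "expectation (\<lambda>\<omega>. B A \<omega> * B A' \<omega>) = 0"
    using prod(1) B_moments(2)[OF A(1)] by (simp add: binaryset_def)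
qed

lemma B_Un:
  assumes A: "A \<in> finite_borel_sets" "A' \<in> finite_borel_sets" and disj: "A \<inter> A' = {}"
  shows "AE \<omega> in M. B (A \<union> A') \<omega> = B A \<omega> + B A' \<omega>"
proof -
  let ?b = "binaryset A A'"
  have "AE \<omega> in M. (\<lambda>i. B (?b i) \<omega>) sums B (\<Union>i. ?b i) \<omega>"
    using A disj finite_borel_sets_Un[OF A]
    by (intro countably_additive_B)
       (auto simp: binaryset_def disjoint_family_on_def UN_binaryset_eq[unfolded binaryset_def])
  with B_empty show ?thesis
  proof eventually_elim
    case (elim \<omega>)
    have "(\<lambda>i. B (?b i) \<omega>) sums (\<Sum>i\<in>{0,1}. B (?b i) \<omega>)"
      using elim(1) by (intro sums_finite) (auto simp: binaryset_def)
    with elim(2) show ?case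
      by (auto simp: UN_binaryset_eq binaryset_def dest: sums_unique2)
  qed
qed

lemma B_UN:
  assumes "finite J" "\<And>j. j \<in> J \<Longrightarrow> A j \<in> finite_borel_sets" "disjoint_family_on A J"
  shows "AE \<omega> in M. B (\<Union>j\<in>J. A j) \<omega> = (\<Sum>j\<in>J. B (A j) \<omega>)"
  using assms
proof (induction J rule: finite_induct)
  case empty
  then show ?case using B_empty by simp
next
  case (insert j J)
  have "AE \<omega> in M. B (\<Union>j\<in>J. A j) \<omega> = (\<Sum>j\<in>J. B (A j) \<omega>)"
    using insert.prems by (intro insert.IH) (auto simp: disjoint_family_on_def)
  moreover have "AE \<omega> in M. B (A j \<union> (\<Union>j\<in>J. A j)) \<omega> = B (A j) \<omega> + B (\<Union>j\<in>J. A j) \<omega>"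
  proof (rule B_Un)
    show "A j \<inter> (\<Union>j\<in>J. A j) = {}"
      using insert.prems(2) insert.hyps(2) by (fastforce simp: disjoint_family_on_def)
  qed (use insert in \<open>auto intro!: finite_borel_sets_UN\<close>)
  ultimately show ?case
    by eventually_elim (use insert.hyps in simp)
qed

text \<open>Pythagoras: by orthogonality only the diagonal terms of the expanded square survive.\<close>

lemma second_moment_sum_B:
  assumes J: "finite J" "\<And>j. j \<in> J \<Longrightarrow> A j \<in> finite_borel_sets" "disjoint_family_on A J"
  shows "(\<integral>\<^sup>+\<omega>. ennreal ((\<Sum>j\<in>J. c j * B (A j) \<omega>)\<^sup>2) \<partial>M)
      = ennreal (\<sigma>\<^sup>2 * (\<Sum>j\<in>J. (c j)\<^sup>2 * measure lborel (A j)))"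
proof -
  have prod: "integrable M (\<lambda>\<omega>. B (A i) \<omega> * B (A j) \<omega>)"
      "expectation (\<lambda>\<omega>. B (A i) \<omega> * B (A j) \<omega>) = (if i = j then \<sigma>\<^sup>2 * measure lborel (A i) else 0)"
    if "i \<in> J" "j \<in> J" for i j
    using that B_moments(3,4)[OF J(2)[of i]] B_orthogonal[OF J(2)[of i] J(2)[of j]] J(3)
    by (cases "i = j"; force simp: power2_eq_square disjoint_family_on_def)+
  have sq: "(\<Sum>j\<in>J. c j * B (A j) \<omega>)\<^sup>2 = (\<Sum>i\<in>J. \<Sum>j\<in>J. c i * c j * (B (A i) \<omega> * B (A j) \<omega>))" for \<omega>
    by (simp add: power2_eq_square sum_product algebra_simps)
  have "(\<integral>\<^sup>+\<omega>. ennreal ((\<Sum>j\<in>J. c j * B (A j) \<omega>)\<^sup>2) \<partial>M)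
      = ennreal (expectation (\<lambda>\<omega>. (\<Sum>j\<in>J. c j * B (A j) \<omega>)\<^sup>2))"
  proof (rule nn_integral_eq_integral)
    show "integrable M (\<lambda>\<omega>. (\<Sum>j\<in>J. c j * B (A j) \<omega>)\<^sup>2)"
      unfolding sq by (intro Bochner_Integration.integrable_sum integrable_mult_right prod)
  qed simp
  also have "expectation (\<lambda>\<omega>. (\<Sum>j\<in>J. c j * B (A j) \<omega>)\<^sup>2)
      = (\<Sum>i\<in>J. \<Sum>j\<in>J. c i * c j * expectation (\<lambda>\<omega>. B (A i) \<omega> * B (A j) \<omega>))"
    unfolding sq
    by (subst Bochner_Integration.integral_sum, (intro Bochner_Integration.integrable_sum integrable_mult_right prod; assumption),
        intro sum.cong refl, subst Bochner_Integration.integral_sum)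
       (auto intro!: integrable_mult_right prod)
  also have "\<dots> = (\<Sum>i\<in>J. \<Sum>j\<in>J. if i = j then c i * c j * (\<sigma>\<^sup>2 * measure lborel (A i)) else 0)"
    by (intro sum.cong refl) (simp add: prod)
  also have "\<dots> = \<sigma>\<^sup>2 * (\<Sum>j\<in>J. (c j)\<^sup>2 * measure lborel (A j))"
    using J(1) by (simp add: sum.delta sum_distrib_left power2_eq_square algebra_simps)
  finally show ?thesis .
qed

text \<open>The integral of a simple function is defined through its canonical representation. This lemma says
  that any finer partition of the line into level sets of a function \<open>q\<close> gives almost surely the same
  value, which is what allows two simple functions to be compared on a common partition. The index set
  \<open>J\<close> may leave out pieces where the function vanishes, as these can have infinite measure.\<close>

lemma simple_wiener_integral_comp:
  assumes fin: "finite (range q)"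
    and J: "J \<subseteq> range q" "\<And>k. k \<in> J \<Longrightarrow> q -` {k} \<in> finite_borel_sets"
    and h0: "\<And>k. k \<in> range q - J \<Longrightarrow> h k = 0"
  shows "AE \<omega> in M. simple_wiener_integral B (\<lambda>x. h (q x)) \<omega> = (\<Sum>k\<in>J. h k * B (q -` {k}) \<omega>)"
proof -
  let ?s = "\<lambda>x. h (q x)"
  let ?K = "\<lambda>c. {k\<in>J. h k = c}"
  have finJ: "finite J" using J(1) fin by (rule finite_subset)
  have rng: "range ?s = h ` range q" by auto
  have level: "?s -` {c} = (\<Union>k\<in>?K c. q -` {k})" if "c \<noteq> 0" for c
    using that h0 by auto
  have "AE \<omega> in M. B (?s -` {c}) \<omega> = (\<Sum>k\<in>?K c. B (q -` {k}) \<omega>)" if "c \<noteq> 0" for c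
    unfolding level[OF that] using finJ J(2)
    by (intro B_UN) (auto simp: disjoint_family_on_def)
  then have "AE \<omega> in M. \<forall>c\<in>range ?s. c \<noteq> 0 \<longrightarrow> B (?s -` {c}) \<omega> = (\<Sum>k\<in>?K c. B (q -` {k}) \<omega>)"
    unfolding rng using fin by (intro AE_finite_allI) auto
  then show ?thesis
  proof eventually_elim
    case (elim \<omega>)
    have "simple_wiener_integral B ?s \<omega> = (\<Sum>c\<in>range ?s. \<Sum>k\<in>?K c. h k * B (q -` {k}) \<omega>)"
      unfolding simple_wiener_integral_def
    proof (rule sum.cong[OF refl])
      fix c assume c: "c \<in> range ?s"
      show "c * B (?s -` {c}) \<omega> = (\<Sum>k\<in>?K c. h k * B (q -` {k}) \<omega>)"
        using elim c by (cases "c = 0") (auto simp: sum_distrib_left intro!: sum.cong)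
    qed
    also have "\<dots> = (\<Sum>k\<in>J. h k * B (q -` {k}) \<omega>)"
      using finJ fin J(1) by (intro sum.group) (auto simp: rng)
    finally show ?case .
  qed
qed

end

section \<open>The Wiener integral of a square integrable function\<close>

lemma has_wiener_integral_wiener_integral:
  "wiener_integrable M B f \<Longrightarrow> has_wiener_integral M B f (wiener_integral M B f)"
  unfolding wiener_integrable_def wiener_integral_def by (rule someI_ex[of "has_wiener_integral M B f"])

context gaussian_random_measure
begin

lemma level_set_finite:
  fixes s :: "real \<Rightarrow> real"
  assumes "Bochner_Integration.simple_bochner_integrable lborel s" "c \<noteq> 0"
  shows "s -` {c} \<in> finite_borel_sets"
proof -
  have s: "simple_function lborel s" "emeasure lborel {x. s x \<noteq> 0} \<noteq> \<infinity>"
    using assms(1) by (auto simp: simple_bochner_integrable.simps)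
  note [measurable] = borel_measurable_simple_function[OF s(1)]
  have "s -` {c} \<inter> space lborel \<in> sets lborel" "{x \<in> space lborel. s x \<noteq> 0} \<in> sets lborel"
    by measurable
  then have "emeasure lborel (s -` {c}) \<le> emeasure lborel {x. s x \<noteq> 0}"
    using assms(2) by (intro emeasure_mono) auto
  also have "\<dots> < \<infinity>" using s(2) by (simp add: less_top)
  finally show ?thesis using \<open>s -` {c} \<inter> space lborel \<in> sets lborel\<close>
    by (simp add: finite_borel_sets_iff)
qed

lemma measurable_simple_wiener_integral:
  assumes "Bochner_Integration.simple_bochner_integrable lborel s"
  shows "simple_wiener_integral B s \<in> borel_measurable M"
proof -
  have "(\<lambda>\<omega>. c * B (s -` {c}) \<omega>) \<in> borel_measurable M" for c
    using measurable_B[OF level_set_finite[OF assms]] by (cases "c = 0") auto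
  then show ?thesis unfolding simple_wiener_integral_def by (rule borel_measurable_sum)
qed

text \<open>Both simple functions are constant on the level sets of \<open>x \<mapsto> (s x, s' x)\<close>. On this common
  partition the difference of the integrals is a single linear combination of orthogonal variables, and
  its second moment is \<open>\<sigma>\<^sup>2\<close> times the integral of \<open>(s - s')\<^sup>2\<close>.\<close>

lemma simple_wiener_isometry:
  assumes s: "Bochner_Integration.simple_bochner_integrable lborel s"
    and s': "Bochner_Integration.simple_bochner_integrable lborel s'"
  shows "sq_dist M (simple_wiener_integral B s) (simple_wiener_integral B s')
       = ennreal (\<sigma>\<^sup>2) * sq_dist lborel s s'"
proof -
  define q where "q x = (s x, s' x)" for x
  define J where "J = range q - {(0, 0)}"
  have "finite (range s)" "finite (range s')"
    using s s' by (auto simp: simple_bochner_integrable.simps simple_function_def)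
  moreover have "range q \<subseteq> range s \<times> range s'" by (auto simp: q_def)
  ultimately have fin: "finite (range q)" by (meson finite_SigmaI finite_subset)
  then have finJ: "finite J" by (simp add: J_def)
  have atom: "q -` {k} \<in> finite_borel_sets" if "k \<in> J" for k
  proof -
    have *: "q -` {k} = s -` {fst k} \<inter> s' -` {snd k}" by (auto simp: q_def)
    have [measurable]: "s \<in> borel_measurable borel" "s' \<in> borel_measurable borel"
      using s s' by (auto simp: simple_bochner_integrable.simps dest: borel_measurable_simple_function)
    have b: "s -` {fst k} \<in> sets borel" "s' -` {snd k} \<in> sets borel"
      using measurable_sets_borel[of s borel "{fst k}"] measurable_sets_borel[of s' borel "{snd k}"] by auto
    from that have "fst k \<noteq> 0 \<or> snd k \<noteq> 0" by (auto simp: J_def prod_eq_iff)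
    then show ?thesis
    proof
      assume "fst k \<noteq> 0"
      from level_set_finite[OF s this] b show ?thesis unfolding * finite_borel_sets_iff
        by (auto intro: le_less_trans[OF emeasure_mono[of _ "s -` {fst k}"]])
    next
      assume "snd k \<noteq> 0"
      from level_set_finite[OF s' this] b show ?thesis unfolding * finite_borel_sets_iff
        by (auto intro: le_less_trans[OF emeasure_mono[of _ "s' -` {snd k}"]])
    qed
  qed
  define c where "c k = fst k - snd k" for k :: "real \<times> real"
  have "AE \<omega> in M. simple_wiener_integral B (\<lambda>x. fst (q x)) \<omega> = (\<Sum>k\<in>J. fst k * B (q -` {k}) \<omega>)"
    by (rule simple_wiener_integral_comp[OF fin _ atom]) (auto simp: J_def q_def)
  moreover
  have "AE \<omega> in M. simple_wiener_integral B (\<lambda>x. snd (q x)) \<omega> = (\<Sum>k\<in>J. snd k * B (q -` {k}) \<omega>)"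
    by (rule simple_wiener_integral_comp[OF fin _ atom]) (auto simp: J_def q_def)
  ultimately
  have "AE \<omega> in M. simple_wiener_integral B s \<omega> - simple_wiener_integral B s' \<omega>
      = (\<Sum>k\<in>J. c k * B (q -` {k}) \<omega>)"
    by eventually_elim (simp add: q_def c_def sum_subtractf left_diff_distrib)
  then have "sq_dist M (simple_wiener_integral B s) (simple_wiener_integral B s')
      = (\<integral>\<^sup>+\<omega>. ennreal ((\<Sum>k\<in>J. c k * B (q -` {k}) \<omega>)\<^sup>2) \<partial>M)"
    unfolding sq_dist_def by (intro nn_integral_cong_AE) (auto elim!: eventually_mono)
  also have "\<dots> = ennreal (\<sigma>\<^sup>2 * (\<Sum>k\<in>J. (c k)\<^sup>2 * measure lborel (q -` {k})))"
    by (rule second_moment_sum_B[OF finJ atom]) (auto simp: disjoint_family_on_def)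
  also have "\<dots> = ennreal (\<sigma>\<^sup>2) * (\<Sum>k\<in>J. ennreal ((c k)\<^sup>2) * emeasure lborel (q -` {k}))"
    using atom by (simp add: ennreal_mult' sum_ennreal[symmetric] sum_nonneg emeasure_eq_ennreal_measure
        finite_borel_sets_iff less_top cong: sum.cong)
  also have "(\<Sum>k\<in>J. ennreal ((c k)\<^sup>2) * emeasure lborel (q -` {k}))
      = (\<integral>\<^sup>+x. (\<Sum>k\<in>J. ennreal ((c k)\<^sup>2) * indicator (q -` {k}) x) \<partial>lborel)"
    using atom
    by (subst nn_integral_sum)
       (auto simp: finite_borel_sets_iff nn_integral_cmult_indicator
         intro!: borel_measurable_times_ennreal borel_measurable_indicator)
  also have "\<dots> = sq_dist lborel s s'"
    unfolding sq_dist_def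
  proof (rule nn_integral_cong)
    fix x
    have "(\<Sum>k\<in>J. ennreal ((c k)\<^sup>2) * indicator (q -` {k}) x) = (\<Sum>k\<in>J. if q x = k then ennreal ((c k)\<^sup>2) else 0)"
      by (intro sum.cong) (auto simp: indicator_def)
    also have "\<dots> = (if q x \<in> J then ennreal ((c (q x))\<^sup>2) else 0)"
      using finJ by (rule sum.delta')
    also have "\<dots> = ennreal ((s x - s' x)\<^sup>2)"
      by (auto simp: J_def c_def q_def)
    finally show "(\<Sum>k\<in>J. ennreal ((c k)\<^sup>2) * indicator (q -` {k}) x) = ennreal ((s x - s' x)\<^sup>2)" .
  qed
  finally show ?thesis .
qed

text \<open>The isometry maps an approximating sequence of \<open>f\<close> to a Cauchy sequence in \<open>L\<^sup>2(M)\<close>, whose limit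
  is an integral of \<open>f\<close>.\<close>

lemma has_wiener_integral_exists:
  assumes f[measurable]: "f \<in> borel_measurable lborel" and fin: "(\<integral>\<^sup>+x. ennreal ((f x)\<^sup>2) \<partial>lborel) < \<infinity>"
  shows "wiener_integrable M B f"
proof -
  obtain s where s: "\<And>n. Bochner_Integration.simple_bochner_integrable lborel (s n)"
    and lim: "(\<lambda>n. sq_dist lborel (s n) f) \<longlonglongrightarrow> 0"
    using simple_functions_dense[OF f fin] by blast
  have [measurable]: "s n \<in> borel_measurable lborel" for n
    using s[of n] by (auto simp: simple_bochner_integrable.simps dest: borel_measurable_simple_function)
  let ?I = "\<lambda>n. simple_wiener_integral B (s n)"
  have "\<exists>Y\<in>borel_measurable M. (\<lambda>n. sq_dist M (?I n) Y) \<longlonglongrightarrow> 0"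
  proof (rule sq_dist_complete)
    show "?I n \<in> borel_measurable M" for n by (rule measurable_simple_wiener_integral[OF s])
    fix e :: real assume e: "e > 0"
    \<comment> \<open>The factor \<open>4\<close> comes from going through \<open>f\<close> with \<open>sq_dist_triangle\<close>; adding \<open>1\<close> to \<open>\<sigma>\<^sup>2\<close> covers
      \<open>\<sigma> = 0\<close>.\<close>
    define d where "d = e / (4 * (\<sigma>\<^sup>2 + 1))"
    have "0 < \<sigma>\<^sup>2 + 1" by (simp add: add_nonneg_pos)
    with e have d: "0 < d" "\<sigma>\<^sup>2 * (4 * d) \<le> e" by (auto simp: d_def field_simps)
    from order_tendstoD(2)[OF lim, of "ennreal d"] d obtain n0 where
      n0: "\<And>n. n \<ge> n0 \<Longrightarrow> sq_dist lborel (s n) f < ennreal d"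
      by (auto simp: eventually_sequentially)
    have "sq_dist M (?I m) (?I n) \<le> ennreal e" if "m \<ge> n0" "n \<ge> n0" for m n
    proof -
      have "sq_dist lborel (s m) (s n) \<le> 2 * sq_dist lborel (s m) f + 2 * sq_dist lborel f (s n)"
        by (rule sq_dist_triangle) measurable
      also have "\<dots> \<le> 2 * ennreal d + 2 * ennreal d"
        using n0[OF that(1)] n0[OF that(2)]
        by (intro add_mono mult_left_mono) (auto simp: sq_dist_commute[of _ f])
      also have "\<dots> = ennreal (4 * d)"
        using d(1) by (simp add: ennreal_mult'[symmetric] ennreal_plus[symmetric] del: ennreal_plus
            flip: ennreal_numeral)
      finally have "ennreal (\<sigma>\<^sup>2) * sq_dist lborel (s m) (s n) \<le> ennreal (\<sigma>\<^sup>2) * ennreal (4 * d)"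
        by (rule mult_left_mono) simp
      also have "\<dots> \<le> ennreal e"
        using d by (simp add: ennreal_mult'[symmetric] ennreal_leI)
      finally show ?thesis by (simp add: simple_wiener_isometry[OF s s])
    qed
    then show "\<exists>n0. \<forall>m\<ge>n0. \<forall>n\<ge>n0. sq_dist M (?I m) (?I n) \<le> ennreal e" by blast
  qed
  then obtain Y where "Y \<in> borel_measurable M" "(\<lambda>n. sq_dist M (?I n) Y) \<longlonglongrightarrow> 0" by blast
  then have "has_wiener_integral M B f Y"
    unfolding has_wiener_integral_def using s lim by (auto simp: sq_dist_def)
  then show ?thesis by (auto simp: wiener_integrable_def)
qed

text \<open>Two approximating sequences of the same \<open>f\<close> approach each other in \<open>L\<^sup>2(\<real>)\<close>, so by the isometry
  their integrals approach each other in \<open>L\<^sup>2(M)\<close>.\<close>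

lemma has_wiener_integral_unique:
  assumes "has_wiener_integral M B f X" "has_wiener_integral M B f Y"
  shows "AE \<omega> in M. X \<omega> = Y \<omega>"
proof -
  from assms(1) obtain s where [measurable]: "f \<in> borel_measurable lborel" "X \<in> borel_measurable M"
    and s: "\<And>n. Bochner_Integration.simple_bochner_integrable lborel (s n)"
    and lim_s: "(\<lambda>n. sq_dist lborel (s n) f) \<longlonglongrightarrow> 0"
      "(\<lambda>n. sq_dist M (simple_wiener_integral B (s n)) X) \<longlonglongrightarrow> 0"
    unfolding has_wiener_integral_def sq_dist_def by blast
  from assms(2) obtain r where [measurable]: "Y \<in> borel_measurable M"
    and r: "\<And>n. Bochner_Integration.simple_bochner_integrable lborel (r n)"
    and lim_r: "(\<lambda>n. sq_dist lborel (r n) f) \<longlonglongrightarrow> 0"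
      "(\<lambda>n. sq_dist M (simple_wiener_integral B (r n)) Y) \<longlonglongrightarrow> 0"
    unfolding has_wiener_integral_def sq_dist_def by blast
  have [measurable]: "s n \<in> borel_measurable lborel" "r n \<in> borel_measurable lborel" for n
    using s[of n] r[of n]
    by (auto simp: simple_bochner_integrable.simps dest: borel_measurable_simple_function)
  define Is where "Is n = simple_wiener_integral B (s n)" for n
  define Ir where "Ir n = simple_wiener_integral B (r n)" for n
  have [measurable]: "Is n \<in> borel_measurable M" "Ir n \<in> borel_measurable M" for n
    unfolding Is_def Ir_def by (rule measurable_simple_wiener_integral s r)+
  have "(\<lambda>n. 2 * sq_dist lborel (s n) f + 2 * sq_dist lborel (r n) f) \<longlonglongrightarrow> 0"
    using lim_s(1) lim_r(1) by (rule tendsto_0_ennreal_linear) auto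
  from tendsto_0_ennreal_linear[OF this lim_r(2), of "2 * ennreal (\<sigma>\<^sup>2)" 2]
  have "(\<lambda>n. 2 * ennreal (\<sigma>\<^sup>2) * (2 * sq_dist lborel (s n) f + 2 * sq_dist lborel (r n) f)
      + 2 * sq_dist M (Ir n) Y) \<longlonglongrightarrow> 0"
    by (simp add: Ir_def ennreal_mult_less_top)
  from tendsto_0_ennreal_linear[OF lim_s(2) this, of 2 2]
  have "(\<lambda>n. 2 * sq_dist M (Is n) X + 2 * (2 * ennreal (\<sigma>\<^sup>2) *
      (2 * sq_dist lborel (s n) f + 2 * sq_dist lborel (r n) f) + 2 * sq_dist M (Ir n) Y)) \<longlonglongrightarrow> 0"
    by (simp add: Is_def)
  moreover have "sq_dist M X Y \<le> 2 * sq_dist M (Is n) X + 2 * (2 * ennreal (\<sigma>\<^sup>2) *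
      (2 * sq_dist lborel (s n) f + 2 * sq_dist lborel (r n) f) + 2 * sq_dist M (Ir n) Y)" for n
  proof -
    have isometry: "sq_dist M (Is n) (Ir n) = ennreal (\<sigma>\<^sup>2) * sq_dist lborel (s n) (r n)"
      unfolding Is_def Ir_def by (rule simple_wiener_isometry[OF s r])
    have "sq_dist M X Y \<le> 2 * sq_dist M (Is n) X + 2 * sq_dist M (Is n) Y"
      unfolding sq_dist_commute[of M "Is n" X] by (rule sq_dist_triangle) measurable
    also have "sq_dist M (Is n) Y \<le> 2 * sq_dist M (Is n) (Ir n) + 2 * sq_dist M (Ir n) Y"
      by (rule sq_dist_triangle) measurable
    also have "2 * sq_dist M (Is n) (Ir n) = 2 * ennreal (\<sigma>\<^sup>2) * sq_dist lborel (s n) (r n)"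
      unfolding isometry by (simp add: mult.assoc)
    also have "sq_dist lborel (s n) (r n) \<le> 2 * sq_dist lborel (s n) f + 2 * sq_dist lborel (r n) f"
      unfolding sq_dist_commute[of lborel "r n" f] by (rule sq_dist_triangle) measurable
    finally show ?thesis by (simp add: add_left_mono add_right_mono mult_left_mono)
  qed
  ultimately have "sq_dist M X Y \<le> 0"
    by (intro LIMSEQ_le_const[of _ 0]) auto
  then show ?thesis by (intro sq_dist_eq_0D) auto
qed

end

text \<open>The level set of \<open>c * s\<close> at \<open>c * y\<close> is the level set of \<open>s\<close> at \<open>y\<close>, so the identity holds for
  every \<open>\<omega>\<close>. For \<open>c = 0\<close> the level sets collapse to a single one.\<close>

lemma simple_wiener_integral_scale:
  assumes "c \<noteq> 0"
  shows "simple_wiener_integral B (\<lambda>x. c * s x) \<omega> = c * simple_wiener_integral B s \<omega>"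
proof -
  have "range (\<lambda>x. c * s x) = (*) c ` range s" by auto
  moreover have "inj_on ((*) c) (range s)" using assms by (auto simp: inj_on_def)
  moreover have "(\<lambda>x. c * s x) -` {c * y} = s -` {y}" for y using assms by auto
  ultimately show ?thesis
    unfolding simple_wiener_integral_def by (simp add: sum.reindex sum_distrib_left mult.assoc)
qed

lemma has_wiener_integral_scale:
  assumes c: "c \<noteq> 0" and M: "gaussian_random_measure M B \<sigma>" and f: "has_wiener_integral M B f X"
  shows "has_wiener_integral M B (\<lambda>x. c * f x) (\<lambda>\<omega>. c * X \<omega>)"
proof -
  interpret gaussian_random_measure M B \<sigma> by (rule M)
  from f obtain s where [measurable]: "f \<in> borel_measurable lborel" "X \<in> borel_measurable M"
    and s: "\<And>n. Bochner_Integration.simple_bochner_integrable lborel (s n)"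
    and lim: "(\<lambda>n. sq_dist lborel (s n) f) \<longlonglongrightarrow> 0"
      "(\<lambda>n. sq_dist M (simple_wiener_integral B (s n)) X) \<longlonglongrightarrow> 0"
    unfolding has_wiener_integral_def sq_dist_def by blast
  have [measurable]: "s n \<in> borel_measurable lborel" for n
    using s[of n] by (auto simp: simple_bochner_integrable.simps dest: borel_measurable_simple_function)
  have [measurable]: "simple_wiener_integral B (s n) \<in> borel_measurable M" for n
    by (rule measurable_simple_wiener_integral[OF s])
  have cs: "Bochner_Integration.simple_bochner_integrable lborel (\<lambda>x. c * s n x)" for n
    using simple_bochner_integrable_compose2[OF _ s[of n] s[of n], of "\<lambda>y _. c * y"] by simp
  have Ics: "simple_wiener_integral B (\<lambda>x. c * s n x) = (\<lambda>\<omega>. c * simple_wiener_integral B (s n) \<omega>)" for n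
    using c by (auto simp: simple_wiener_integral_scale)
  have "(\<lambda>n. sq_dist lborel (\<lambda>x. c * s n x) (\<lambda>x. c * f x)) \<longlonglongrightarrow> 0"
    using tendsto_0_ennreal_linear[OF lim(1) lim(1), of "ennreal (c\<^sup>2)" 0]
    by (simp add: sq_dist_scale)
  moreover have "(\<lambda>n. sq_dist M (simple_wiener_integral B (\<lambda>x. c * s n x)) (\<lambda>\<omega>. c * X \<omega>)) \<longlonglongrightarrow> 0"
    using tendsto_0_ennreal_linear[OF lim(2) lim(2), of "ennreal (c\<^sup>2)" 0]
    by (simp add: sq_dist_scale Ics)
  ultimately show ?thesis
    unfolding has_wiener_integral_def using cs
    by (intro conjI exI[of _ "\<lambda>n x. c * s n x"]) (simp_all add: sq_dist_def)
qed

section \<open>The tempered kernel and its fractional integral\<close>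

definition tempered_kernel :: "real \<Rightarrow> real \<Rightarrow> real \<Rightarrow> real" where
  "tempered_kernel a lam x = pos x powr (a - 1) * exp (- lam * pos x)"

lemma measurable_pos [measurable]: "pos \<in> borel_measurable borel"
  unfolding pos_def[abs_def] by measurable

lemma measurable_tempered_kernel [measurable]: "tempered_kernel a lam \<in> borel_measurable borel"
  unfolding tempered_kernel_def[abs_def] by measurable

lemma tempered_kernel_nonneg [simp]: "0 \<le> tempered_kernel a lam x"
  by (simp add: tempered_kernel_def)

text \<open>The substitution \<open>x \<mapsto> x / lam\<close> reduces the total mass to Euler's integral for \<open>\<Gamma>(a)\<close>.\<close>

lemma nn_integral_tempered_kernel:
  assumes "a > 0" "lam > 0"
  shows "(\<integral>\<^sup>+x. ennreal (tempered_kernel a lam x) \<partial>lborel) = ennreal (Gamma a / lam powr a)"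
proof -
  have "(\<integral>\<^sup>+x. ennreal (tempered_kernel a lam x) \<partial>lborel)
      = ennreal (1 / lam) * (\<integral>\<^sup>+x. ennreal (tempered_kernel a lam (x / lam)) \<partial>lborel)"
    using assms by (subst nn_integral_real_affine[of _ "1 / lam" 0]) auto
  also have "(\<integral>\<^sup>+x. ennreal (tempered_kernel a lam (x / lam)) \<partial>lborel)
      = (\<integral>\<^sup>+x. ennreal (lam powr (1 - a)) * ennreal (indicator {0..} x * x powr (a - 1) / exp x) \<partial>lborel)"
  proof (rule nn_integral_cong)
    fix x
    have "tempered_kernel a lam (x / lam) = lam powr (1 - a) * (indicator {0..} x * x powr (a - 1) / exp x)"
      using assms by (auto simp: tempered_kernel_def pos_def powr_divide exp_minus field_simps
          powr_diff indicator_def zero_less_divide_iff)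
    then show "ennreal (tempered_kernel a lam (x / lam))
        = ennreal (lam powr (1 - a)) * ennreal (indicator {0..} x * x powr (a - 1) / exp x)"
      by (simp only: ennreal_mult'[OF powr_ge_zero])
  qed
  also have "\<dots> = ennreal (lam powr (1 - a)) * ennreal (Gamma a)"
    using assms by (simp add: nn_integral_cmult Gamma_conv_nn_integral_real)
  also have "ennreal (1 / lam) * \<dots> = ennreal (Gamma a / lam powr a)"
    using assms by (simp add: ennreal_mult'[symmetric] powr_diff)
  finally show ?thesis .
qed

text \<open>This is a case of Young's convolution inequality. The function is bounded by the mass \<open>K\<close> of the
  kernel, and by Tonelli its integral is \<open>K\<close> times the measure of the window \<open>A\<close>; hence the integral of
  its square is at most \<open>K\<^sup>2\<close> times the measure of \<open>A\<close>.\<close>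

lemma square_integrable_window_convolution:
  fixes k :: "real \<Rightarrow> real"
  assumes k[measurable]: "k \<in> borel_measurable borel" and nonneg: "\<And>x. 0 \<le> k x"
    and fin: "(\<integral>\<^sup>+x. ennreal (k x) \<partial>lborel) < \<infinity>" and A[measurable]: "A \<in> sets borel" "emeasure lborel A < \<infinity>"
  shows "(\<lambda>y. LBINT u. indicator A u * k (u - y)) \<in> borel_measurable lborel"
    and "(\<integral>\<^sup>+y. ennreal ((LBINT u. indicator A u * k (u - y))\<^sup>2) \<partial>lborel) < \<infinity>"
proof -
  define K where "K = (\<integral>\<^sup>+x. ennreal (k x) \<partial>lborel)"
  define G where "G y = (\<integral>\<^sup>+u. ennreal (indicator A u * k (u - y)) \<partial>lborel)" for y
  let ?g = "\<lambda>y. LBINT u. indicator A u * k (u - y)"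
  show "?g \<in> borel_measurable lborel" by measurable
  have [measurable]: "G \<in> borel_measurable borel" unfolding G_def by measurable
  have "G y \<le> (\<integral>\<^sup>+u. ennreal (k (u - y)) \<partial>lborel)" for y
    unfolding G_def by (intro nn_integral_mono) (auto simp: indicator_def)
  also have "(\<integral>\<^sup>+u. ennreal (k (u - y)) \<partial>lborel) = K" for y
    unfolding K_def by (subst nn_integral_real_affine[of "\<lambda>x. ennreal (k x)" 1 "- y"]) auto
  finally have G_le: "G y \<le> K" for y .
  have g: "ennreal (?g y) = G y" for y
  proof -
    have "?g y = enn2real (G y)"
      unfolding G_def by (rule integral_eq_nn_integral) (auto simp: nonneg)
    moreover have "G y < \<infinity>" using G_le[of y] fin by (auto simp: K_def intro: le_less_trans)
    ultimately show ?thesis by simp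
  qed
  have reflect: "(\<integral>\<^sup>+y. ennreal (k (u - y)) \<partial>lborel) = K" for u
    unfolding K_def by (subst nn_integral_real_affine[of "\<lambda>x. ennreal (k x)" "-1" u]) auto
  have "(\<integral>\<^sup>+y. ennreal ((?g y)\<^sup>2) \<partial>lborel) = (\<integral>\<^sup>+y. G y * G y \<partial>lborel)"
    by (simp add: power2_eq_square ennreal_mult' g nonneg)
  also have "\<dots> \<le> (\<integral>\<^sup>+y. K * G y \<partial>lborel)"
    by (intro nn_integral_mono mult_right_mono G_le) simp
  also have "\<dots> = K * (\<integral>\<^sup>+y. G y \<partial>lborel)"
    by (rule nn_integral_cmult) measurable
  also have "(\<integral>\<^sup>+y. G y \<partial>lborel) = (\<integral>\<^sup>+u. \<integral>\<^sup>+y. ennreal (indicator A u * k (u - y)) \<partial>lborel \<partial>lborel)"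
    unfolding G_def by (rule lborel_pair.Fubini') measurable
  also have "\<dots> = (\<integral>\<^sup>+u. K * indicator A u \<partial>lborel)"
    by (intro nn_integral_cong) (auto simp: indicator_def reflect)
  also have "K * (\<integral>\<^sup>+u. K * indicator A u \<partial>lborel) < \<infinity>"
    using fin A by (simp add: nn_integral_cmult_indicator ennreal_mult_less_top K_def)
  finally show "(\<integral>\<^sup>+y. ennreal ((?g y)\<^sup>2) \<partial>lborel) < \<infinity>" .
qed

lemma neg_tempered_frac_integral_indicator:
  "neg_tempered_frac_integral a lam (indicat_real A) y
     = 1 / Gamma a * (LBINT u. indicat_real A u * tempered_kernel a lam (u - y))"
  by (simp add: neg_tempered_frac_integral_def tempered_kernel_def mult.assoc)

text \<open>The interval integral is taken over the open interval, the fractional integral over the closed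
  one; the end points do not matter, so the identity holds at every \<open>y\<close>.\<close>

lemma interval_integral_eq_frac_integral:
  fixes a lam t y :: real
  assumes "a > 0" "t \<ge> 0"
  shows "(LBINT s=0..t. pos (s - y) powr (a - 1) * exp (- lam * pos (s - y)))
     = Gamma a * neg_tempered_frac_integral a lam (indicat_real {0..t}) y"
proof -
  have "(LBINT s=ereal 0..ereal t. tempered_kernel a lam (s - y)) = (LBINT s : {0..t}. tempered_kernel a lam (s - y))"
    using assms(2) by (rule interval_integral_Icc)
  then show ?thesis
    using Gamma_real_pos[OF assms(1)]
    by (simp add: neg_tempered_frac_integral_indicator set_lebesgue_integral_def tempered_kernel_def zero_ereal_def)
qed

section \<open>The tempered Hermite process as a Wiener integral\<close>

theorem lemma3p1:
  fixes M :: "'a measure" and B :: "real set \<Rightarrow> 'a \<Rightarrow> real" and \<sigma> H lam t :: real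
  assumes "gaussian_random_measure M B \<sigma>"
    and "H > 1 / 2"
    and "lam > 0"
    and "t \<ge> 0"
  shows "wiener_integrable M B (neg_tempered_frac_integral (H - 1 / 2) lam (indicat_real {0..t}))
    \<and> (AE \<omega> in M. tempered_hermite1 M B H lam t \<omega> =
         Gamma (H - 1 / 2) *
         wiener_integral M B
           (neg_tempered_frac_integral (H - 1 / 2) lam (indicat_real {0..t})) \<omega>)"
proof -
  interpret gaussian_random_measure M B \<sigma> by (rule assms(1))
  define a where "a = H - 1 / 2"
  have a: "a > 0" using assms(2) by (simp add: a_def)
  define c where "c = Gamma a"
  have c: "c \<noteq> 0" using Gamma_real_pos[OF a] by (simp add: c_def)
  define F where "F = neg_tempered_frac_integral a lam (indicat_real {0..t})"
  have F_eq: "F y = 1 / c * (LBINT u. indicat_real {0..t} u * tempered_kernel a lam (u - y))" for y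
    unfolding F_def c_def by (rule neg_tempered_frac_integral_indicator)
  have kernel_mass: "(\<integral>\<^sup>+x. ennreal (tempered_kernel a lam x) \<partial>lborel) < \<infinity>"
    using a assms(3) by (simp add: nn_integral_tempered_kernel)
  have window: "emeasure lborel {0..t} < \<infinity>" using assms(4) by simp
  note conv = square_integrable_window_convolution[OF measurable_tempered_kernel
      tempered_kernel_nonneg kernel_mass _ window]
  have F_meas: "F \<in> borel_measurable lborel"
    unfolding F_eq[abs_def] using conv(1) by simp
  have F_sq: "ennreal ((F y)\<^sup>2) = ennreal ((1 / c)\<^sup>2) *
      ennreal ((LBINT u. indicat_real {0..t} u * tempered_kernel a lam (u - y))\<^sup>2)" for y
    unfolding F_eq power_mult_distrib by (rule ennreal_mult') simp
  have "(\<integral>\<^sup>+y. ennreal ((F y)\<^sup>2) \<partial>lborel) < \<infinity>"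
    unfolding F_sq using conv
    by (subst nn_integral_cmult) (auto simp: ennreal_mult_less_top)
  then have integrable: "wiener_integrable M B F"
    by (rule has_wiener_integral_exists[OF F_meas])
  then have "has_wiener_integral M B F (wiener_integral M B F)"
    by (rule has_wiener_integral_wiener_integral)
  then have scaled: "has_wiener_integral M B (\<lambda>y. c * F y) (\<lambda>\<omega>. c * wiener_integral M B F \<omega>)"
    by (rule has_wiener_integral_scale[OF c assms(1)])
  then have "has_wiener_integral M B (\<lambda>y. c * F y) (wiener_integral M B (\<lambda>y. c * F y))"
    by (intro has_wiener_integral_wiener_integral) (auto simp: wiener_integrable_def)
  from has_wiener_integral_unique[OF this scaled]
  have "AE \<omega> in M. wiener_integral M B (\<lambda>y. c * F y) \<omega> = c * wiener_integral M B F \<omega>" .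
  moreover have "tempered_hermite1 M B H lam t = wiener_integral M B (\<lambda>y. c * F y)"
    using interval_integral_eq_frac_integral[OF a assms(4)]
    unfolding tempered_hermite1_def c_def F_def by (simp add: a_def)
  ultimately show ?thesis using integrable by (simp add: F_def c_def a_def)
qed

end
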